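(* Let $\Pi$ be a probability measure on a product $\mathcal X\times\mathcal Y$ of Polish spaces, let $P$ be the two-component deterministic-scan Gibbs kernel and $P_X$ its $X$-marginal kernel. Suppose that $P^*P$ satisfies a weak Poincaré inequality with function $\beta:(0,\infty)\to(0,\infty)$: $$\|f\|_\Pi^2\le s\,\mathcal E_\Pi(P^*P,f)+\beta(s)\|f\|_{\mathrm{osc}}^2\qquad\forall s>0,\ f\in L^2_0(\Pi).$$ Then $P_X^*P_X$ satisfies a weak Poincaré inequality with the same function $\beta$: $$\|g\|_{\Pi_X}^2\le s\,\mathcal E_{\Pi_X}(P_X^*P_X,g)+\beta(s)\|g\|_{\mathrm{osc}}^2\qquad\forall s>0,\ g\in L^2_0(\Pi_X).$$
   Context: For a probability measure $\mu$: $L^2_0(\mu)$ is the space of mean-zero functions in $L^2(\mu)$, $\|f\|_\mu^2=\int f^2d\mu$, $\|f\|_{\mathrm{osc}}=\operatorname{ess\,sup}_\mu f-\operatorname{ess\,inf}_\mu f$. A $\mu$-invariant Markov kernel $T$ acts by $(Tf)(x)=\int f(x')T(x,dx')$, $T^*$ is its $L^2(\mu)$-adjoint, and $\mathcal E_\mu(T,f)=\langle (I-T)f,f\rangle_\mu$. In a weak Poincaré inequality the function $\beta$ is decreasing with $\lim_{s\to\infty}\beta(s)=0$. $\Pi_X,\Pi_Y$ are the marginals of $\Pi$ and $\Pi_{Y|X},\Pi_{X|Y}$ the conditionals. The deterministic-scan Gibbs kernel is $P((x,y),(dx',dy'))=\Pi_{Y|X}(dy'|x)\,\Pi_{X|Y}(dx'|y')$,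 and the $X$-marginal kernel is $P_X(x,dx')=\int_{\mathcal Y}\Pi_{X|Y}(dx'|y)\,\Pi_{Y|X}(dy|x)$, which is $\Pi_X$-reversible. *)

theory Defs
  imports "HOL-Probability.Probability"
begin

text \<open>
  Elements of \<open>L\<^sup>2(\<mu>)\<close> are represented by measurable functions instead of classes modulo
  almost-everywhere equality. The quantities below that enter the weak Poincare inequality do not
  depend on the choice of representatives.
\<close>

definition L2 :: "'a measure \<Rightarrow> ('a \<Rightarrow> real) set" where
  "L2 \<mu> = {f \<in> borel_measurable \<mu>. integrable \<mu> (\<lambda>x. (f x)\<^sup>2)}"

definition L2_zero :: "'a measure \<Rightarrow> ('a \<Rightarrow> real) set" where
  "L2_zero \<mu> = {f \<in> L2 \<mu>. (\<integral>x. f x \<partial>\<mu>) = 0}"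

definition L2_inner :: "'a measure \<Rightarrow> ('a \<Rightarrow> real) \<Rightarrow> ('a \<Rightarrow> real) \<Rightarrow> real" where
  "L2_inner \<mu> f g = (\<integral>x. f x * g x \<partial>\<mu>)"

definition L2_norm :: "'a measure \<Rightarrow> ('a \<Rightarrow> real) \<Rightarrow> real" where
  "L2_norm \<mu> f = sqrt (\<integral>x. (f x)\<^sup>2 \<partial>\<mu>)"

definition essinf :: "'a measure \<Rightarrow> ('a \<Rightarrow> ereal) \<Rightarrow> ereal" where
  "essinf \<mu> f = - esssup \<mu> (\<lambda>x. - f x)"

text \<open>
  Extended-real valued, because a function in \<open>L\<^sup>2(\<mu>)\<close> need not be essentially bounded. For a
  real-valued measurable function and a probability measure \<open>\<mu>\<close> the subtraction is never of
  the form \<open>\<infinity> - \<infinity>\<close>.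
\<close>

definition osc_norm :: "'a measure \<Rightarrow> ('a \<Rightarrow> real) \<Rightarrow> ereal" where
  "osc_norm \<mu> f = esssup \<mu> (\<lambda>x. ereal (f x)) - essinf \<mu> (\<lambda>x. ereal (f x))"

definition kernel_op :: "('a \<Rightarrow> 'a measure) \<Rightarrow> ('a \<Rightarrow> real) \<Rightarrow> 'a \<Rightarrow> real" where
  "kernel_op T f x = (\<integral>x'. f x' \<partial>T x)"

text \<open>
  For an operator \<open>A\<close> bounded on \<open>L\<^sup>2(\<mu>)\<close> and \<open>f\<close> in \<open>L\<^sup>2(\<mu>)\<close>, such an \<open>h\<close> exists and is unique
  up to a \<open>\<mu>\<close>-null set; the choice operator picks a representative.
\<close>

definition L2_adjoint ::
    "'a measure \<Rightarrow> (('a \<Rightarrow> real) \<Rightarrow> ('a \<Rightarrow> real)) \<Rightarrow> ('a \<Rightarrow> real) \<Rightarrow> 'a \<Rightarrow> real" where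
  "L2_adjoint \<mu> A f =
     (SOME h. h \<in> L2 \<mu> \<and> (\<forall>g\<in>L2 \<mu>. L2_inner \<mu> (A g) f = L2_inner \<mu> g h))"

definition adjoint_self_op :: "'a measure \<Rightarrow> ('a \<Rightarrow> 'a measure) \<Rightarrow> ('a \<Rightarrow> real) \<Rightarrow> 'a \<Rightarrow> real" where
  "adjoint_self_op \<mu> T = L2_adjoint \<mu> (kernel_op T) \<circ> kernel_op T"

definition dirichlet_form ::
    "'a measure \<Rightarrow> (('a \<Rightarrow> real) \<Rightarrow> ('a \<Rightarrow> real)) \<Rightarrow> ('a \<Rightarrow> real) \<Rightarrow> real" where
  "dirichlet_form \<mu> A f = L2_inner \<mu> (\<lambda>x. f x - A f x) f"

definition weak_poincare ::
    "'a measure \<Rightarrow> (('a \<Rightarrow> real) \<Rightarrow> ('a \<Rightarrow> real)) \<Rightarrow> (real \<Rightarrow> real) \<Rightarrow> bool" where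
  "weak_poincare \<mu> A \<beta> \<longleftrightarrow>
     (\<forall>s>0. \<beta> s > 0) \<and> antimono_on {0<..} \<beta> \<and> (\<beta> \<longlongrightarrow> 0) at_top \<and>
     (\<forall>s>0. \<forall>f\<in>L2_zero \<mu>.
        ereal ((L2_norm \<mu> f)\<^sup>2)
          \<le> ereal (s * dirichlet_form \<mu> A f) + ereal (\<beta> s) * (osc_norm \<mu> f)\<^sup>2)"

text \<open>
  \<open>K\<close> is a version of the regular conditional distribution of \<open>V\<close> given \<open>U\<close> under \<open>M\<close>. On Polish
  spaces such a \<open>K\<close> exists and is unique up to a null set of the law of \<open>U\<close>.
\<close>

definition regular_conditional ::
    "'c measure \<Rightarrow> ('c \<Rightarrow> 'a::topological_space) \<Rightarrow> ('c \<Rightarrow> 'b::topological_space)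
       \<Rightarrow> ('a \<Rightarrow> 'b measure) \<Rightarrow> bool" where
  "regular_conditional M U V K \<longleftrightarrow>
     K \<in> borel \<rightarrow>\<^sub>M prob_algebra borel \<and>
     (\<forall>A\<in>sets borel. \<forall>B\<in>sets borel.
        emeasure M {\<omega> \<in> space M. U \<omega> \<in> A \<and> V \<omega> \<in> B}
          = (\<integral>\<^sup>+u\<in>A. emeasure (K u) B \<partial>distr M borel U))"

text \<open>Below, \<open>KY\<close> and \<open>KX\<close> stand for the conditionals of \<open>Y\<close> given \<open>X\<close> and of \<open>X\<close> given \<open>Y\<close>.\<close>

definition gibbs_kernel ::
    "('a::topological_space \<Rightarrow> 'b::topological_space measure) \<Rightarrow> ('b \<Rightarrow> 'a measure)
       \<Rightarrow> 'a \<times> 'b \<Rightarrow> ('a \<times> 'b) measure" where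
  "gibbs_kernel KY KX = (\<lambda>(x, y).
     KY x \<bind> (\<lambda>y'. KX y' \<bind> (\<lambda>x'. return (borel \<Otimes>\<^sub>M borel) (x', y'))))"

definition gibbs_X_kernel ::
    "('a \<Rightarrow> 'b measure) \<Rightarrow> ('b \<Rightarrow> 'a measure) \<Rightarrow> 'a \<Rightarrow> 'a measure" where
  "gibbs_X_kernel KY KX x = KY x \<bind> KX"

end

theory Submission
  imports Defs
begin

text \<open>
  The Dirichlet form of \<open>T\<^sup>* T\<close> at \<open>f\<close> is \<open>\<parallel>f\<parallel>\<^sup>2 - \<parallel>T f\<parallel>\<^sup>2\<close>, and the Gibbs kernel maps
  \<open>g \<circ> fst\<close> to \<open>(P\<^sub>X g) \<circ> fst\<close>. Hence the inequality for \<open>P\<^sub>X\<close> at \<open>g\<close> is the one for \<open>P\<close> at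
  \<open>g \<circ> fst\<close>. The adjoints are defined by choice, so the needed values must be shown to exist:
  disintegrating \<open>\<Pi>\<close> along each coordinate shows that \<open>P\<^sup>*\<close> maps \<open>u \<circ> fst\<close> to the function
  \<open>(x, y) \<mapsto> \<integral>u d\<Pi>(\<cdot>|y)\<close>.
\<close>

section \<open>Square-integrable functions, image measures and the Dirichlet form\<close>

lemma L2_measurable [dest]: "f \<in> L2 M \<Longrightarrow> f \<in> borel_measurable M"
  by (simp add: L2_def)

lemma L2_integrable_square: "f \<in> L2 M \<Longrightarrow> integrable M (\<lambda>x. (f x)\<^sup>2)"
  by (simp add: L2_def)

lemma L2_integrable_mult:
  assumes f: "f \<in> L2 M" and g: "g \<in> L2 M"
  shows "integrable M (\<lambda>x. f x * g x)"
proof (rule Bochner_Integration.integrable_bound)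
  show "integrable M (\<lambda>x. (f x)\<^sup>2 + (g x)\<^sup>2)"
    by (rule Bochner_Integration.integrable_add[OF L2_integrable_square[OF f] L2_integrable_square[OF g]])
  show "(\<lambda>x. f x * g x) \<in> borel_measurable M"
    using f g by (auto simp: L2_def)
  have "norm (a * b) \<le> norm (a\<^sup>2 + b\<^sup>2)" for a b :: real
  proof -
    have "norm (a * b) \<le> 2 * \<bar>a\<bar> * \<bar>b\<bar>"
      by (simp add: abs_mult)
    also have "\<dots> \<le> norm (a\<^sup>2 + b\<^sup>2)"
      using sum_squares_bound[of "\<bar>a\<bar>" "\<bar>b\<bar>"] by simp
    finally show ?thesis .
  qed
  then show "AE x in M. norm (f x * g x) \<le> norm ((f x)\<^sup>2 + (g x)\<^sup>2)"
    by (intro AE_I2)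
qed

lemma (in prob_space) L2_integrable:
  assumes "f \<in> L2 M"
  shows "integrable M f"
proof -
  have "(\<lambda>_. 1) \<in> L2 M"
    by (simp add: L2_def)
  from L2_integrable_mult[OF assms this] show ?thesis
    by simp
qed

lemma L2_distr_iff:
  assumes "p \<in> M \<rightarrow>\<^sub>M N" "f \<in> borel_measurable N"
  shows "f \<in> L2 (distr M N p) \<longleftrightarrow> (\<lambda>x. f (p x)) \<in> L2 M"
  using assms by (simp add: L2_def integrable_distr_eq)

lemma L2_norm_distr:
  assumes "p \<in> M \<rightarrow>\<^sub>M N" "f \<in> borel_measurable N"
  shows "L2_norm (distr M N p) f = L2_norm M (\<lambda>x. f (p x))"
  using assms by (simp add: L2_norm_def integral_distr)

lemma L2_inner_distr:
  assumes "p \<in> M \<rightarrow>\<^sub>M N" "f \<in> borel_measurable N" "g \<in> borel_measurable N"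
  shows "L2_inner (distr M N p) f g = L2_inner M (\<lambda>x. f (p x)) (\<lambda>x. g (p x))"
  using assms by (simp add: L2_inner_def integral_distr)

lemma L2_zero_distr_iff:
  assumes "p \<in> M \<rightarrow>\<^sub>M N" "f \<in> borel_measurable N"
  shows "f \<in> L2_zero (distr M N p) \<longleftrightarrow> (\<lambda>x. f (p x)) \<in> L2_zero M"
  using assms by (simp add: L2_zero_def L2_distr_iff integral_distr)

text \<open>For measurable functions the essential supremum is the infimum of the almost sure upper
  bounds, and \<open>z\<close> is such a bound for \<open>f\<close> under the image measure exactly
  if it is one for the composite with \<open>p\<close> under \<open>M\<close>.\<close>

lemma esssup_distr:
  fixes f :: "'a \<Rightarrow> ereal"
  assumes p: "p \<in> M \<rightarrow>\<^sub>M N" and f [measurable]: "f \<in> borel_measurable N"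
  shows "esssup (distr M N p) f = esssup M (\<lambda>x. f (p x))"
proof -
  have "(\<lambda>x. f (p x)) \<in> borel_measurable M"
    using p by measurable
  moreover have "(AE x in distr M N p. f x \<le> z) \<longleftrightarrow> (AE x in M. f (p x) \<le> z)" for z
    using p by (intro AE_distr_iff) auto
  ultimately show ?thesis
    by (simp add: esssup_eq_AE)
qed

lemma osc_norm_distr:
  assumes "p \<in> M \<rightarrow>\<^sub>M N" "f \<in> borel_measurable N"
  shows "osc_norm (distr M N p) f = osc_norm M (\<lambda>x. f (p x))"
  using assms by (simp add: osc_norm_def essinf_def esssup_distr)

text \<open>The formula of \<open>kernel_op\<close>, but with different types for source and target,
  so that it also covers the conditionals \<open>KY\<close>, \<open>KX\<close> and the fibre kernels
  \<open>SY\<close>, \<open>SX\<close>.\<close>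

definition kernel_integral :: "('a \<Rightarrow> 'b measure) \<Rightarrow> ('b \<Rightarrow> real) \<Rightarrow> 'a \<Rightarrow> real" where
  "kernel_integral K f x = (\<integral>y. f y \<partial>K x)"

lemma kernel_op_eq_kernel_integral: "kernel_op T = kernel_integral T"
  by (simp add: fun_eq_iff kernel_op_def kernel_integral_def)

text \<open>The function \<open>h\<close> serves to show that the choice in
  \<open>L2_adjoint\<close> has a candidate. Whichever representative is chosen, testing the adjoint
  relation at \<open>f\<close> itself turns its inner product with \<open>f\<close> into the squared
  norm of \<open>T f\<close>.\<close>

lemma dirichlet_form_adjoint_self_op:
  assumes f: "f \<in> L2 \<mu>" and h: "h \<in> L2 \<mu>"
    and adj: "\<And>g. g \<in> L2 \<mu> \<Longrightarrow> L2_inner \<mu> (kernel_integral T g) (kernel_integral T f) = L2_inner \<mu> g h"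
  shows "dirichlet_form \<mu> (adjoint_self_op \<mu> T) f
    = L2_inner \<mu> f f - L2_inner \<mu> (kernel_integral T f) (kernel_integral T f)"
proof -
  define h' where "h' = adjoint_self_op \<mu> T f"
  have "h' \<in> L2 \<mu> \<and> (\<forall>g\<in>L2 \<mu>. L2_inner \<mu> (kernel_integral T g) (kernel_integral T f) = L2_inner \<mu> g h')"
    unfolding h'_def adjoint_self_op_def L2_adjoint_def comp_def kernel_op_eq_kernel_integral
    by (rule someI[of _ h]) (use h adj in auto)
  then have h': "h' \<in> L2 \<mu>" "L2_inner \<mu> (kernel_integral T f) (kernel_integral T f) = L2_inner \<mu> f h'"
    using f by auto
  have "dirichlet_form \<mu> (adjoint_self_op \<mu> T) f = (\<integral>x. f x * f x - f x * h' x \<partial>\<mu>)"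
    by (simp add: dirichlet_form_def L2_inner_def h'_def algebra_simps)
  also have "\<dots> = L2_inner \<mu> f f - L2_inner \<mu> f h'"
    using L2_integrable_mult[OF f f] L2_integrable_mult[OF f h'(1)] by (simp add: L2_inner_def)
  finally show ?thesis
    using h'(2) by simp
qed

section \<open>Integration of unbounded functions against a mixture of kernels\<close>

lemma integrable_bindD:
  fixes f :: "'b \<Rightarrow> real"
  assumes K [measurable]: "K \<in> M \<rightarrow>\<^sub>M prob_algebra B"
    and ne: "space M \<noteq> {}"
    and f: "integrable (M \<bind> K) f"
  shows AE_integrable_bind: "AE x in M. integrable (K x) f"
    and integrable_kernel_integral: "integrable M (kernel_integral K f)"
    and integral_bind_kernel_integral: "(\<integral>z. f z \<partial>(M \<bind> K)) = (\<integral>x. kernel_integral K f x \<partial>M)"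
proof -
  have K' [measurable]: "K \<in> M \<rightarrow>\<^sub>M subprob_algebra B"
    by (rule measurable_prob_algebraD[OF K])
  have sK: "sets (K x) = sets B" if "x \<in> space M" for x
    by (rule sets_kernel[OF K' that])
  have sMK: "sets (M \<bind> K) = sets B"
    using sK ne by (rule sets_bind)
  have fB [measurable]: "f \<in> borel_measurable B"
    using borel_measurable_integrable[OF f] sMK by (simp cong: measurable_cong_sets)
  have fK: "f \<in> borel_measurable (K x)" if "x \<in> space M" for x
    using fB sK[OF that] by (simp cong: measurable_cong_sets)
  have meas: "kernel_integral K f \<in> borel_measurable M"
    unfolding kernel_integral_def using measurable_compose[OF K' integral_measurable_subprob_algebra[OF fB]] .
  have nn_meas: "(\<lambda>x. \<integral>\<^sup>+z. ennreal (g z) \<partial>K x) \<in> borel_measurable M" if "g \<in> borel_measurable B" for g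
    using that by (intro measurable_compose[OF K' nn_integral_measurable_subprob_algebra]) auto
  \<comment> \<open>Tonelli for the absolute value of \<open>f\<close>: the iterated integral is
    finite, hence so is the inner one for almost every \<open>x\<close>. Integrability under each
    single \<open>K x\<close> cannot be expected.\<close>
  have fin: "(\<integral>\<^sup>+x. \<integral>\<^sup>+z. ennreal \<bar>f z\<bar> \<partial>K x \<partial>M) < \<infinity>"
    using f by (subst nn_integral_bind[OF _ K', symmetric]) (auto simp: integrable_iff_bounded)
  have "AE x in M. (\<integral>\<^sup>+z. ennreal \<bar>f z\<bar> \<partial>K x) \<noteq> \<infinity>"
    using fin by (intro nn_integral_PInf_AE nn_meas) auto
  then show int: "AE x in M. integrable (K x) f"
    using AE_space by eventually_elim (auto simp: integrable_iff_bounded less_top fK)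
  have "(\<integral>\<^sup>+x. ennreal (norm (kernel_integral K f x)) \<partial>M) \<le> (\<integral>\<^sup>+x. \<integral>\<^sup>+z. ennreal \<bar>f z\<bar> \<partial>K x \<partial>M)"
    using int by (intro nn_integral_mono_AE, eventually_elim)
      (use integral_norm_bound_ennreal in \<open>force simp: kernel_integral_def\<close>)
  then show "integrable M (kernel_integral K f)"
    using fin meas by (auto simp: integrable_iff_bounded)
  \<comment> \<open>Used with \<open>g = f\<close> and with \<open>g\<close> the negative of
    \<open>f\<close>. Since \<open>ennreal\<close> sends negative numbers to 0, these are the
    positive and the negative part of \<open>f\<close>. Both inner integrals are almost surely
    finite, so \<open>enn2real\<close> loses nothing.\<close>
  have part: "integrable M (\<lambda>x. enn2real (\<integral>\<^sup>+z. ennreal (g z) \<partial>K x))"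
      "enn2real (\<integral>\<^sup>+z. ennreal (g z) \<partial>(M \<bind> K)) = (\<integral>x. enn2real (\<integral>\<^sup>+z. ennreal (g z) \<partial>K x) \<partial>M)"
    if g: "g \<in> borel_measurable B" "\<And>z. g z \<le> \<bar>f z\<bar>" for g
  proof -
    let ?G = "\<lambda>x. \<integral>\<^sup>+z. ennreal (g z) \<partial>K x"
    have le: "(\<integral>\<^sup>+x. ?G x \<partial>M) \<le> (\<integral>\<^sup>+x. \<integral>\<^sup>+z. ennreal \<bar>f z\<bar> \<partial>K x \<partial>M)"
      using g by (intro nn_integral_mono ennreal_leI) auto
    then have lt: "(\<integral>\<^sup>+x. ?G x \<partial>M) < \<infinity>"
      using fin by (rule order.strict_trans1)
    have "AE x in M. ?G x \<noteq> \<infinity>"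
      using lt by (intro nn_integral_PInf_AE nn_meas g) auto
    then have "AE x in M. ?G x = ennreal (enn2real (?G x))"
      by eventually_elim (simp add: less_top)
    then have eq: "(\<integral>\<^sup>+x. ?G x \<partial>M) = (\<integral>\<^sup>+x. ennreal (enn2real (?G x)) \<partial>M)"
      by (rule nn_integral_cong_AE)
    show "integrable M (\<lambda>x. enn2real (?G x))"
      using lt eq nn_meas[OF g(1)] by (auto simp: integrable_iff_bounded)
    have "(\<integral>x. enn2real (?G x) \<partial>M) = enn2real (\<integral>\<^sup>+x. ennreal (enn2real (?G x)) \<partial>M)"
      using nn_meas[OF g(1)] by (intro integral_eq_nn_integral) auto
    also have "\<dots> = enn2real (\<integral>\<^sup>+z. ennreal (g z) \<partial>(M \<bind> K))"
      using g by (subst nn_integral_bind[OF _ K']) (auto simp: eq)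
    finally show "enn2real (\<integral>\<^sup>+z. ennreal (g z) \<partial>(M \<bind> K)) = (\<integral>x. enn2real (?G x) \<partial>M)" ..
  qed
  have pos: "f \<in> borel_measurable B" "\<And>z. f z \<le> \<bar>f z\<bar>"
    and neg: "(\<lambda>z. - f z) \<in> borel_measurable B" "\<And>z. - f z \<le> \<bar>f z\<bar>"
    by auto
  have "(\<integral>z. f z \<partial>(M \<bind> K))
      = (\<integral>x. enn2real (\<integral>\<^sup>+z. f z \<partial>K x) - enn2real (\<integral>\<^sup>+z. - f z \<partial>K x) \<partial>M)"
    using part[OF pos] part[OF neg] by (simp add: real_lebesgue_integral_def[OF f])
  also have "\<dots> = (\<integral>x. kernel_integral K f x \<partial>M)"
  proof (rule integral_cong_AE)
    \<comment> \<open>Where \<open>f\<close> is not integrable under \<open>K x\<close>, the Bochner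
      integral has the default value 0 and the difference may not; hence the equality is claimed
      only almost everywhere.\<close>
    show "AE x in M. enn2real (\<integral>\<^sup>+z. f z \<partial>K x) - enn2real (\<integral>\<^sup>+z. - f z \<partial>K x) = kernel_integral K f x"
      using int by eventually_elim (simp add: kernel_integral_def real_lebesgue_integral_def)
    show "(\<lambda>x. enn2real (\<integral>\<^sup>+z. f z \<partial>K x) - enn2real (\<integral>\<^sup>+z. - f z \<partial>K x)) \<in> borel_measurable M"
      using nn_meas[OF pos(1)] nn_meas[OF neg(1)] by measurable
  qed (rule meas)
  finally show "(\<integral>z. f z \<partial>(M \<bind> K)) = (\<integral>x. kernel_integral K f x \<partial>M)" .
qed

text \<open>The difference of the two sides is the variance of \<open>f\<close>, which is
  nonnegative.\<close>

lemma (in prob_space) square_expectation_le: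
  assumes "f \<in> L2 M"
  shows "(\<integral>x. f x \<partial>M)\<^sup>2 \<le> (\<integral>x. (f x)\<^sup>2 \<partial>M)"
  using variance_eq[OF L2_integrable[OF assms] L2_integrable_square[OF assms]] variance_positive[of f]
  by simp

text \<open>Jensen on each fibre bounds the square of the kernel integral of \<open>f\<close> by the
  kernel integral of the square of \<open>f\<close>, and the latter is integrable over
  \<open>M\<close>.\<close>

lemma L2_kernel_integral:
  assumes K: "K \<in> M \<rightarrow>\<^sub>M prob_algebra B" and ne: "space M \<noteq> {}" and f: "f \<in> L2 (M \<bind> K)"
  shows "kernel_integral K f \<in> L2 M"
proof -
  have K': "K \<in> M \<rightarrow>\<^sub>M subprob_algebra B"
    by (rule measurable_prob_algebraD[OF K])
  have sK: "sets (K x) = sets B" "prob_space (K x)" if "x \<in> space M" for x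
    using measurable_space[OF K that] by (auto simp: space_prob_algebra)
  have sMK: "sets (M \<bind> K) = sets B"
    using sK(1) ne by (rule sets_bind)
  have fB: "f \<in> borel_measurable B"
    using L2_measurable[OF f] sMK by (simp cong: measurable_cong_sets)
  have meas: "kernel_integral K f \<in> borel_measurable M"
    unfolding kernel_integral_def using measurable_compose[OF K' integral_measurable_subprob_algebra[OF fB]] .
  note sq = L2_integrable_square[OF f]
  have "AE x in M. integrable (K x) (\<lambda>z. (f z)\<^sup>2)"
    by (rule AE_integrable_bind[OF K ne sq])
  then have "AE x in M. norm ((kernel_integral K f x)\<^sup>2) \<le> norm (kernel_integral K (\<lambda>z. (f z)\<^sup>2) x)"
    using AE_space
  proof eventually_elim
    case (elim x)
    interpret Kx: prob_space "K x" by (rule sK(2)[OF elim(2)])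
    have "f \<in> L2 (K x)"
      using elim fB sK(1) by (simp add: L2_def cong: measurable_cong_sets)
    from Kx.square_expectation_le[OF this] show ?case
      by (simp add: kernel_integral_def)
  qed
  then have "integrable M (\<lambda>x. (kernel_integral K f x)\<^sup>2)"
    using meas by (intro Bochner_Integration.integrable_bound[OF integrable_kernel_integral[OF K ne sq]]) auto
  with meas show ?thesis
    by (simp add: L2_def)
qed

text \<open>The intended \<open>a\<close> has the constant value \<open>b x\<close> on the fibre
  that carries \<open>S x\<close>, so it leaves the inner integral. In this way
  \<open>kernel_integral S\<close> becomes the adjoint of lifting a function from the base.\<close>

lemma L2_inner_bind:
  assumes S: "S \<in> M \<rightarrow>\<^sub>M prob_algebra B" and ne: "space M \<noteq> {}"
    and a: "a \<in> L2 (M \<bind> S)" and f: "f \<in> L2 (M \<bind> S)"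
    and pull_out: "\<And>x. kernel_integral S (\<lambda>z. a z * f z) x = b x * kernel_integral S f x"
  shows "L2_inner (M \<bind> S) a f = L2_inner M b (kernel_integral S f)"
  using integral_bind_kernel_integral[OF S ne L2_integrable_mult[OF a f]]
  by (simp add: L2_inner_def pull_out)

text \<open>Associativity of the mixture makes \<open>f\<close> integrable under
  \<open>K x \<bind> L\<close> for almost every \<open>x\<close>, and at such \<open>x\<close> the
  iterated integral formula applies. Elsewhere default values could break the identity.\<close>

lemma AE_kernel_integral_bind:
  assumes K: "K \<in> M \<rightarrow>\<^sub>M prob_algebra N" and L: "L \<in> N \<rightarrow>\<^sub>M prob_algebra B"
    and ne: "space M \<noteq> {}" and f: "integrable ((M \<bind> K) \<bind> L) f"
  shows "AE x in M. kernel_integral (\<lambda>x. K x \<bind> L) f x = kernel_integral K (kernel_integral L f) x"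
proof -
  have eq: "(M \<bind> K) \<bind> L = M \<bind> (\<lambda>x. K x \<bind> L)"
    by (rule bind_assoc[OF measurable_prob_algebraD[OF K] measurable_prob_algebraD[OF L]])
  have "AE x in M. integrable (K x \<bind> L) f"
    using f unfolding eq by (rule AE_integrable_bind[OF measurable_bind_prob_space[OF K L] ne])
  then show ?thesis
    using AE_space
  proof eventually_elim
    case (elim x)
    have Kx: "sets (K x) = sets N" "prob_space (K x)"
      using measurable_space[OF K elim(2)] by (auto simp: space_prob_algebra)
    have "L \<in> K x \<rightarrow>\<^sub>M prob_algebra B"
      using L Kx(1) by (simp cong: measurable_cong_sets)
    from integral_bind_kernel_integral[OF this prob_space.not_empty[OF Kx(2)] elim(1)]
    show ?case
      by (simp add: kernel_integral_def)
  qed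
qed

section \<open>Disintegration of a joint law along a coordinate\<close>

lemma measurable_distr_Pair:
  assumes "K \<in> M \<rightarrow>\<^sub>M prob_algebra N"
  shows "(\<lambda>x. distr (K x) (M \<Otimes>\<^sub>M N) (Pair x)) \<in> M \<rightarrow>\<^sub>M prob_algebra (M \<Otimes>\<^sub>M N)"
    and "(\<lambda>x. distr (K x) (N \<Otimes>\<^sub>M M) (\<lambda>y. (y, x))) \<in> M \<rightarrow>\<^sub>M prob_algebra (N \<Otimes>\<^sub>M M)"
  using assms by (intro measurable_distr_prob_space2[where M = N]; simp)+

text \<open>The definition of a regular conditional is the equality of the two measures on
  rectangles. Rectangles are stable under intersection and generate the product \<sigma>-algebra,
  and the measures are finite, so they coincide.\<close>

lemma regular_conditional_disintegration:
  fixes U :: "'c \<Rightarrow> 'a::topological_space" and V :: "'c \<Rightarrow> 'b::topological_space"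
  assumes "prob_space M" and UV [measurable]: "U \<in> M \<rightarrow>\<^sub>M borel" "V \<in> M \<rightarrow>\<^sub>M borel"
    and "regular_conditional M U V K"
  shows "distr M (borel \<Otimes>\<^sub>M borel) (\<lambda>\<omega>. (U \<omega>, V \<omega>))
    = distr M borel U \<bind> (\<lambda>u. distr (K u) (borel \<Otimes>\<^sub>M borel) (Pair u))" (is "?L = ?R")
proof -
  interpret prob_space M by fact
  let ?S = "\<lambda>u. distr (K u) (borel \<Otimes>\<^sub>M borel) (Pair u)"
  have K: "K \<in> borel \<rightarrow>\<^sub>M prob_algebra borel"
    and rect: "\<And>A B. A \<in> sets borel \<Longrightarrow> B \<in> sets borel \<Longrightarrow>
      emeasure M {\<omega> \<in> space M. U \<omega> \<in> A \<and> V \<omega> \<in> B} = (\<integral>\<^sup>+u\<in>A. emeasure (K u) B \<partial>distr M borel U)"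
    using assms(4) by (auto simp: regular_conditional_def)
  have sK: "sets (K u) = sets borel" for u
    using measurable_space[OF K, of u] by (simp add: space_prob_algebra)
  have S: "?S \<in> distr M borel U \<rightarrow>\<^sub>M subprob_algebra (borel \<Otimes>\<^sub>M borel)"
    using measurable_prob_algebraD[OF measurable_distr_Pair(1)[OF K]] by simp
  let ?E = "{A \<times> B | A B. A \<in> sets borel \<and> B \<in> sets borel} :: ('a \<times> 'b) set set"
  show ?thesis
  proof (rule measure_eqI_generator_eq[where E = ?E and \<Omega> = UNIV and A = "\<lambda>_. UNIV"])
    show "Int_stable ?E"
      by (rule Int_stable_pair_measure_generator)
    show "sets ?L = sigma_sets UNIV ?E"
      by (simp add: sets_pair_measure)
    show "sets ?R = sigma_sets UNIV ?E"
      by (subst sets_bind[where N = "borel \<Otimes>\<^sub>M borel"]) (auto simp: sets_pair_measure)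
    show "range (\<lambda>_::nat. UNIV) \<subseteq> ?E"
      by (auto intro!: exI[of _ UNIV])
    show "emeasure ?L UNIV \<noteq> \<infinity>"
    proof -
      interpret L: prob_space ?L
        by (rule prob_space_distr) simp
      show ?thesis
        using L.emeasure_finite by simp
    qed
    fix X assume "X \<in> ?E"
    then obtain A B where X: "X = A \<times> B" and AB: "A \<in> sets borel" "B \<in> sets borel"
      by auto
    have XS: "X \<in> sets (borel \<Otimes>\<^sub>M borel)"
      using AB by (simp add: X)
    have "emeasure ?L X = emeasure M {\<omega> \<in> space M. U \<omega> \<in> A \<and> V \<omega> \<in> B}"
      using XS by (subst emeasure_distr) (auto simp: X intro!: arg_cong[where f = "emeasure M"])
    also have "\<dots> = (\<integral>\<^sup>+u. emeasure (?S u) X \<partial>distr M borel U)"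
      unfolding rect[OF AB]
    proof (rule nn_integral_cong)
      fix u
      have "Pair u \<in> K u \<rightarrow>\<^sub>M borel \<Otimes>\<^sub>M borel"
        using sK by (simp cong: measurable_cong_sets)
      \<comment> \<open>The section of a rectangle is \<open>B\<close> or empty, which accounts for
        the indicator of \<open>A\<close> in the conditional formula.\<close>
      moreover have "Pair u -` X \<inter> space (K u) = (if u \<in> A then B else {})"
        using sets_eq_imp_space_eq[OF sK, of u] by (auto simp: X)
      ultimately show "emeasure (K u) B * indicator A u = emeasure (?S u) X"
        using XS by (simp add: emeasure_distr)
    qed
    also have "\<dots> = emeasure ?R X"
      by (rule emeasure_bind[OF _ S XS, symmetric]) simp
    finally show "emeasure ?L X = emeasure ?R X" .
  qed auto
qed

text \<open>This is the defining identity on rectangles with \<open>A\<close> the whole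
  space.\<close>

lemma regular_conditional_marginal:
  assumes M: "prob_space M" and UV [measurable]: "U \<in> M \<rightarrow>\<^sub>M borel" "V \<in> M \<rightarrow>\<^sub>M borel"
    and K: "regular_conditional M U V K"
  shows "distr M borel V = distr M borel U \<bind> K"
proof (rule measure_eqI)
  interpret prob_space M by fact
  have K': "K \<in> borel \<rightarrow>\<^sub>M prob_algebra borel"
    and rect: "\<And>A B. A \<in> sets borel \<Longrightarrow> B \<in> sets borel \<Longrightarrow>
      emeasure M {\<omega> \<in> space M. U \<omega> \<in> A \<and> V \<omega> \<in> B} = (\<integral>\<^sup>+u\<in>A. emeasure (K u) B \<partial>distr M borel U)"
    using K by (auto simp: regular_conditional_def)
  have "K \<in> distr M borel U \<rightarrow>\<^sub>M subprob_algebra borel"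
    using measurable_prob_algebraD[OF K'] by simp
  note K'' = this
  show "sets (distr M borel V) = sets (distr M borel U \<bind> K)"
    using sets_kernel[OF K''] by (subst sets_bind[where N = borel]) auto
  fix B assume "B \<in> sets (distr M borel V)"
  then have B: "B \<in> sets borel" by simp
  have "emeasure (distr M borel V) B = emeasure M {\<omega> \<in> space M. U \<omega> \<in> UNIV \<and> V \<omega> \<in> B}"
    using B by (subst emeasure_distr) (auto intro!: arg_cong[where f = "emeasure M"])
  also have "\<dots> = emeasure (distr M borel U \<bind> K) B"
    using rect[OF _ B, of UNIV] by (simp add: emeasure_bind[OF _ K'' B])
  finally show "emeasure (distr M borel V) B = emeasure (distr M borel U \<bind> K) B" .
qed

section \<open>The joint law, its fibre kernels and the two Gibbs kernels\<close>

locale two_component_gibbs = prob_space \<pi>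
  for \<pi> :: "('a::topological_space \<times> 'b::topological_space) measure" +
  fixes KY :: "'a \<Rightarrow> 'b measure" and KX :: "'b \<Rightarrow> 'a measure"
  assumes sets_\<pi>: "sets \<pi> = sets (borel \<Otimes>\<^sub>M borel)"
    and cond_Y: "regular_conditional \<pi> fst snd KY"
    and cond_X: "regular_conditional \<pi> snd fst KX"
begin

abbreviation \<mu> :: "'a measure" where "\<mu> \<equiv> distr \<pi> borel fst"
abbreviation \<nu> :: "'b measure" where "\<nu> \<equiv> distr \<pi> borel snd"

text \<open>The conditional law of the whole pair given its first coordinate, carried by the fibre
  over \<open>x\<close>. Unlike \<open>KY\<close>, it can integrate functions of both coordinates,
  so \<open>kernel_integral SY\<close> is conditional expectation given the first coordinate;
  \<open>SX\<close> is the analogue for the second.\<close>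

definition SY :: "'a \<Rightarrow> ('a \<times> 'b) measure" where
  "SY x = distr (KY x) (borel \<Otimes>\<^sub>M borel) (Pair x)"

definition SX :: "'b \<Rightarrow> ('a \<times> 'b) measure" where
  "SX y = distr (KX y) (borel \<Otimes>\<^sub>M borel) (\<lambda>x. (x, y))"

lemma measurable_\<pi>_eq: "measurable \<pi> = measurable (borel \<Otimes>\<^sub>M borel)"
  by (intro ext measurable_cong_sets sets_\<pi> refl)

lemma measurable_coord [measurable]: "fst \<in> \<pi> \<rightarrow>\<^sub>M borel" "snd \<in> \<pi> \<rightarrow>\<^sub>M borel"
  by (simp_all add: measurable_\<pi>_eq)

lemma KY: "KY \<in> borel \<rightarrow>\<^sub>M prob_algebra borel" and KX: "KX \<in> borel \<rightarrow>\<^sub>M prob_algebra borel"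
  using cond_X cond_Y by (auto simp: regular_conditional_def)

lemma sets_KY: "sets (KY x) = sets borel" and sets_KX: "sets (KX y) = sets borel"
  and prob_space_KY: "prob_space (KY x)" and prob_space_KX: "prob_space (KX y)"
  using measurable_space[OF KY, of x] measurable_space[OF KX, of y] by (auto simp: space_prob_algebra)

lemma measurable_KY_eq: "measurable (KY x) = measurable borel"
  and measurable_KX_eq: "measurable (KX y) = measurable borel"
  by (intro ext measurable_cong_sets sets_KY sets_KX refl)+

lemma SY: "SY \<in> borel \<rightarrow>\<^sub>M prob_algebra (borel \<Otimes>\<^sub>M borel)"
  and SX: "SX \<in> borel \<rightarrow>\<^sub>M prob_algebra (borel \<Otimes>\<^sub>M borel)"
  unfolding SY_def SX_def by (rule measurable_distr_Pair[OF KY] measurable_distr_Pair[OF KX])+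

lemma kernels_\<mu>: "KY \<in> \<mu> \<rightarrow>\<^sub>M prob_algebra borel" "SY \<in> \<mu> \<rightarrow>\<^sub>M prob_algebra (borel \<Otimes>\<^sub>M borel)"
  and kernels_\<nu>: "KX \<in> \<nu> \<rightarrow>\<^sub>M prob_algebra borel" "SX \<in> \<nu> \<rightarrow>\<^sub>M prob_algebra (borel \<Otimes>\<^sub>M borel)"
  using KY SY KX SX by simp_all

lemma bind_SY: "\<mu> \<bind> SY = \<pi>"
proof -
  have "distr \<pi> (borel \<Otimes>\<^sub>M borel) (\<lambda>\<omega>. (fst \<omega>, snd \<omega>)) = \<pi>"
    using sets_\<pi> by (simp add: distr_id2)
  then show ?thesis
    using regular_conditional_disintegration[OF prob_space_axioms measurable_coord cond_Y]
    by (simp add: SY_def[abs_def])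
qed

text \<open>The disintegration lemma puts the conditioning coordinate first, so it is applied to the
  swapped pair, and the result is swapped back fibre by fibre.\<close>

lemma bind_SX: "\<nu> \<bind> SX = \<pi>"
proof -
  let ?B = "borel \<Otimes>\<^sub>M borel :: ('b \<times> 'a) measure"
  let ?D = "\<lambda>y. distr (KX y) ?B (Pair y)" and ?s = "\<lambda>z. (snd z, fst z)"
  have D: "?D \<in> \<nu> \<rightarrow>\<^sub>M subprob_algebra ?B"
    using measurable_prob_algebraD[OF measurable_distr_Pair(1)[OF KX]] by simp
  have "distr (distr \<pi> ?B ?s) (borel \<Otimes>\<^sub>M borel) ?s = \<pi>"
    using sets_\<pi> by (subst distr_distr) (simp_all add: comp_def distr_id2)
  then have "\<pi> = distr (distr \<pi> ?B ?s) (borel \<Otimes>\<^sub>M borel) ?s" ..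
  also have "\<dots> = \<nu> \<bind> (\<lambda>y. distr (?D y) (borel \<Otimes>\<^sub>M borel) ?s)"
    unfolding regular_conditional_disintegration[OF prob_space_axioms measurable_coord(2,1) cond_X]
    by (rule distr_bind[OF D]) simp_all
  also have "(\<lambda>y. distr (?D y) (borel \<Otimes>\<^sub>M borel) ?s) = SX"
    by (simp add: fun_eq_iff SX_def distr_distr measurable_KX_eq comp_def)
  finally show ?thesis ..
qed

lemma bind_KY: "\<mu> \<bind> KY = \<nu>"
  by (rule regular_conditional_marginal[OF prob_space_axioms measurable_coord cond_Y, symmetric])

lemma bind_KX: "\<nu> \<bind> KX = \<mu>"
  by (rule regular_conditional_marginal[OF prob_space_axioms measurable_coord(2,1) cond_X, symmetric])

text \<open>Drawing \<open>x'\<close> while keeping \<open>y'\<close> is a draw from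
  \<open>SX y'\<close>. The form also shows that the starting point enters only through its first
  coordinate.\<close>

lemma gibbs_kernel_eq: "gibbs_kernel KY KX z = KY (fst z) \<bind> SX"
proof -
  have "KX y \<bind> (\<lambda>x. return (borel \<Otimes>\<^sub>M borel) (x, y)) = SX y" for y
    unfolding SX_def
    by (rule bind_return_distr'[OF prob_space.not_empty[OF prob_space_KX]]) (simp add: measurable_KX_eq)
  then show ?thesis
    by (simp add: gibbs_kernel_def split_beta)
qed

text \<open>The first marginal of \<open>SX y\<close> is \<open>KX y\<close>, so projecting the
  Gibbs move to the first coordinate gives the marginal kernel.\<close>

lemma gibbs_X_kernel_eq: "gibbs_X_kernel KY KX x = distr (KY x \<bind> SX) borel fst"
proof -
  have "distr (KY x \<bind> SX) borel fst = KY x \<bind> (\<lambda>y. distr (SX y) borel fst)"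
    using measurable_prob_algebraD[OF SX] prob_space.not_empty[OF prob_space_KY]
    by (intro distr_bind[where K = "borel \<Otimes>\<^sub>M borel"]) (simp_all add: measurable_KY_eq)
  also have "(\<lambda>y. distr (SX y) borel fst) = KX"
    by (simp add: fun_eq_iff SX_def distr_distr measurable_KX_eq comp_def sets_KX distr_id2)
  finally show ?thesis
    by (simp add: gibbs_X_kernel_def)
qed

text \<open>The intertwining of the two operators. It holds at every point, not just almost
  everywhere, because it is a change of variables along \<open>fst\<close> and needs only
  measurability of \<open>g\<close>.\<close>

lemma kernel_integral_gibbs_fst:
  assumes g: "g \<in> borel_measurable borel"
  shows "kernel_integral (gibbs_kernel KY KX) (\<lambda>z. g (fst z)) = (\<lambda>z. kernel_integral (gibbs_X_kernel KY KX) g (fst z))"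
proof
  fix z :: "'a \<times> 'b"
  have "sets (KY (fst z) \<bind> SX) = sets (borel \<Otimes>\<^sub>M borel)"
    using sets_kernel[OF measurable_prob_algebraD[OF SX]] prob_space.not_empty[OF prob_space_KY]
    by (intro sets_bind) simp_all
  then have "fst \<in> (KY (fst z) \<bind> SX) \<rightarrow>\<^sub>M borel"
    by (simp cong: measurable_cong_sets)
  then show "kernel_integral (gibbs_kernel KY KX) (\<lambda>z. g (fst z)) z = kernel_integral (gibbs_X_kernel KY KX) g (fst z)"
    using g by (simp add: kernel_integral_def gibbs_kernel_eq gibbs_X_kernel_eq integral_distr)
qed

section \<open>Adjoints of the Gibbs operators and comparison of the Dirichlet forms\<close>

lemma kernel_integral_SY_snd: "f \<in> borel_measurable borel \<Longrightarrow> kernel_integral SY (\<lambda>z. f (snd z)) = kernel_integral KY f"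
  and kernel_integral_SX_fst: "g \<in> borel_measurable borel \<Longrightarrow> kernel_integral SX (\<lambda>z. g (fst z)) = kernel_integral KX g"
  by (simp_all add: kernel_integral_def fun_eq_iff SY_def SX_def integral_distr measurable_KY_eq measurable_KX_eq)

text \<open>A function of the first coordinate is constant on the fibres of \<open>SY\<close>, so
  conditional expectation given that coordinate is adjoint to composition with
  \<open>fst\<close>.\<close>

lemma L2_inner_SY:
  assumes a: "a \<in> L2 \<mu>" and f: "f \<in> L2 \<pi>"
  shows "L2_inner \<pi> (\<lambda>z. a (fst z)) f = L2_inner \<mu> a (kernel_integral SY f)"
proof (rule L2_inner_bind[OF kernels_\<mu>(2), unfolded bind_SY])
  have a': "a \<in> borel_measurable borel" and f': "f \<in> borel_measurable (borel \<Otimes>\<^sub>M borel)"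
    using a f by (simp_all add: L2_def measurable_\<pi>_eq)
  show "(\<lambda>z. a (fst z)) \<in> L2 \<pi>"
    using a a' by (simp add: L2_distr_iff)
  show "kernel_integral SY (\<lambda>z. a (fst z) * f z) x = a x * kernel_integral SY f x" for x
    using a' f' by (simp add: kernel_integral_def SY_def integral_distr measurable_KY_eq)
qed (use f in simp_all)

lemma L2_inner_SX:
  assumes a: "a \<in> L2 \<nu>" and f: "f \<in> L2 \<pi>"
  shows "L2_inner \<pi> (\<lambda>z. a (snd z)) f = L2_inner \<nu> a (kernel_integral SX f)"
proof (rule L2_inner_bind[OF kernels_\<nu>(2), unfolded bind_SX])
  have a': "a \<in> borel_measurable borel" and f': "f \<in> borel_measurable (borel \<Otimes>\<^sub>M borel)"
    using a f by (simp_all add: L2_def measurable_\<pi>_eq)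
  show "(\<lambda>z. a (snd z)) \<in> L2 \<pi>"
    using a a' by (simp add: L2_distr_iff)
  show "kernel_integral SX (\<lambda>z. a (snd z) * f z) y = a y * kernel_integral SX f y" for y
    using a' f' by (simp add: kernel_integral_def SX_def integral_distr measurable_KX_eq)
qed (use f in simp_all)

text \<open>The Gibbs operator conditions on the second coordinate, giving \<open>G\<close>, and
  then on the first. Moving these two steps across the inner product one at a time leaves
  \<open>kernel_integral KX u\<close>, lifted by \<open>snd\<close>. Functions of the form
  \<open>u (fst z)\<close> are the right test functions, as every value of the Gibbs operator has
  this form.\<close>

lemma L2_inner_gibbs:
  assumes g: "g \<in> L2 \<pi>" and u: "u \<in> L2 \<mu>"
  shows "L2_inner \<pi> (kernel_integral (gibbs_kernel KY KX) g) (\<lambda>z. u (fst z))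
    = L2_inner \<pi> g (\<lambda>z. kernel_integral KX u (snd z))"
proof -
  define G where "G = kernel_integral SX g"
  have ne: "space \<mu> \<noteq> {}" "space \<nu> \<noteq> {}"
    by simp_all
  have u': "u \<in> borel_measurable borel" and g': "g \<in> borel_measurable (borel \<Otimes>\<^sub>M borel)"
    using u g by (simp_all add: L2_def measurable_\<pi>_eq)
  have G: "G \<in> L2 \<nu>"
    unfolding G_def using L2_kernel_integral[OF kernels_\<nu>(2) ne(2)] g by (simp add: bind_SX)
  then have G': "G \<in> borel_measurable borel"
    by (simp add: L2_def)
  have Ku: "kernel_integral KX u \<in> L2 \<nu>"
    using L2_kernel_integral[OF kernels_\<nu>(1) ne(2)] u by (simp add: bind_KX)
  have KG: "kernel_integral KY G \<in> L2 \<mu>"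
    using L2_kernel_integral[OF kernels_\<mu>(1) ne(1)] G by (simp add: bind_KY)
  have lift: "(\<lambda>z. u (fst z)) \<in> L2 \<pi>" "(\<lambda>z. G (snd z)) \<in> L2 \<pi>"
    using u u' G G' by (simp_all add: L2_distr_iff)
  \<comment> \<open>The Gibbs kernel as a function of the first coordinate of its starting point, so
    that the inner product descends to \<mu>.\<close>
  define P where "P = (\<lambda>x. KY x \<bind> SX)"
  have P: "kernel_integral P g \<in> borel_measurable borel"
    unfolding P_def kernel_integral_def
    by (rule measurable_compose[OF measurable_prob_algebraD[OF measurable_bind_prob_space[OF KY SX]]
          integral_measurable_subprob_algebra[OF g']])
  have ae: "AE x in \<mu>. kernel_integral P g x = kernel_integral KY G x"
    unfolding P_def G_def
    by (rule AE_kernel_integral_bind[OF kernels_\<mu>(1) SX ne(1)]) (simp add: bind_KY bind_SX L2_integrable g)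
  have "L2_inner \<pi> (kernel_integral (gibbs_kernel KY KX) g) (\<lambda>z. u (fst z)) = L2_inner \<mu> (kernel_integral P g) u"
  proof -
    have "kernel_integral (gibbs_kernel KY KX) g = (\<lambda>z. kernel_integral P g (fst z))"
      by (simp add: fun_eq_iff kernel_integral_def gibbs_kernel_eq P_def)
    then show ?thesis
      using P u' by (simp add: L2_inner_distr)
  qed
  \<comment> \<open>Reading \<open>kernel_integral KY G\<close> as the conditional expectation of
    \<open>G (snd z)\<close> allows the pairing with \<open>u\<close> to be lifted back to
    \<pi>.\<close>
  also have "\<dots> = L2_inner \<mu> u (kernel_integral SY (\<lambda>z. G (snd z)))"
    unfolding L2_inner_def kernel_integral_SY_snd[OF G']
    using ae P u' L2_measurable[OF KG] by (intro integral_cong_AE) auto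
  also have "\<dots> = L2_inner \<pi> (\<lambda>z. G (snd z)) (\<lambda>z. u (fst z))"
    unfolding L2_inner_SY[OF u lift(2), symmetric] by (simp add: L2_inner_def mult.commute)
  also have "\<dots> = L2_inner \<nu> (kernel_integral KX u) G"
    unfolding L2_inner_SX[OF G lift(1)] kernel_integral_SX_fst[OF u'] by (simp add: L2_inner_def mult.commute)
  also have "\<dots> = L2_inner \<pi> g (\<lambda>z. kernel_integral KX u (snd z))"
    unfolding G_def L2_inner_SX[OF Ku g, symmetric] by (simp add: L2_inner_def mult.commute)
  finally show ?thesis .
qed

text \<open>Both sides equal the squared norm of \<open>g\<close> minus that of its image
  \<open>u\<close> under the marginal kernel. The adjoint witnesses are
  \<open>kernel_integral KX u\<close> lifted by \<open>snd\<close> on the product, and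
  \<open>kernel_integral KY (kernel_integral KX u)\<close> on the first factor. The latter is almost
  everywhere the marginal kernel applied to \<open>u\<close>, in accordance with
  reversibility.\<close>

lemma dirichlet_form_gibbs:
  assumes g: "g \<in> L2 \<mu>"
  shows "dirichlet_form \<pi> (adjoint_self_op \<pi> (gibbs_kernel KY KX)) (\<lambda>z. g (fst z))
    = dirichlet_form \<mu> (adjoint_self_op \<mu> (gibbs_X_kernel KY KX)) g"
proof -
  let ?P = "gibbs_kernel KY KX" and ?PX = "gibbs_X_kernel KY KX"
  have g': "g \<in> borel_measurable borel"
    using g by (simp add: L2_def)
  have lift: "(\<lambda>z. f (fst z)) \<in> L2 \<pi>" if "f \<in> L2 \<mu>" for f
    using that L2_distr_iff[of fst \<pi> borel f] by (auto simp: L2_def)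
  have ne: "space \<mu> \<noteq> {}" "space \<nu> \<noteq> {}"
    by simp_all
  define u where "u = kernel_integral ?PX g"
  have u: "u \<in> L2 \<mu>"
  proof -
    have PX: "?PX \<in> \<mu> \<rightarrow>\<^sub>M prob_algebra borel"
      unfolding gibbs_X_kernel_def[abs_def] using measurable_bind_prob_space[OF KY KX] by simp
    \<comment> \<open>Invariance, via \<mu> to \<nu> and back; it is what places \<open>u\<close> in
      \<open>L2 \<mu>\<close>.\<close>
    have "\<mu> \<bind> ?PX = \<mu>"
      unfolding gibbs_X_kernel_def[abs_def]
      using bind_assoc[OF kernels_\<mu>(1)[THEN measurable_prob_algebraD] KX[THEN measurable_prob_algebraD]]
      by (simp add: bind_KY bind_KX)
    then show ?thesis
      unfolding u_def using L2_kernel_integral[OF PX ne(1)] g by simp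
  qed
  have Ku: "kernel_integral KX u \<in> L2 \<nu>"
    using L2_kernel_integral[OF kernels_\<nu>(1) ne(2)] u by (simp add: bind_KX)
  then have Ku': "kernel_integral KX u \<in> borel_measurable borel"
    by (simp add: L2_def)
  have h: "(\<lambda>z. kernel_integral KX u (snd z)) \<in> L2 \<pi>"
    using Ku Ku' by (simp add: L2_distr_iff)
  have KKu: "kernel_integral KY (kernel_integral KX u) \<in> L2 \<mu>"
    using L2_kernel_integral[OF kernels_\<mu>(1) ne(1)] Ku by (simp add: bind_KY)
  have Pg: "kernel_integral ?P (\<lambda>z. g (fst z)) = (\<lambda>z. u (fst z))"
    unfolding u_def by (rule kernel_integral_gibbs_fst[OF g'])
  have inner: "L2_inner \<mu> f f' = L2_inner \<pi> (\<lambda>z. f (fst z)) (\<lambda>z. f' (fst z))"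
    if "f \<in> borel_measurable borel" "f' \<in> borel_measurable borel" for f f'
    using that by (simp add: L2_inner_distr)
  have u': "u \<in> borel_measurable borel"
    using u by (simp add: L2_def)
  have "dirichlet_form \<pi> (adjoint_self_op \<pi> ?P) (\<lambda>z. g (fst z))
      = L2_inner \<pi> (\<lambda>z. g (fst z)) (\<lambda>z. g (fst z)) - L2_inner \<pi> (\<lambda>z. u (fst z)) (\<lambda>z. u (fst z))"
    using dirichlet_form_adjoint_self_op[OF lift[OF g] h, of ?P] L2_inner_gibbs[OF _ u]
    by (simp add: Pg)
  also have "\<dots> = L2_inner \<mu> g g - L2_inner \<mu> u u"
    using g' u' by (simp add: inner)
  also have "\<dots> = dirichlet_form \<mu> (adjoint_self_op \<mu> ?PX) g"
    unfolding u_def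
  proof (rule dirichlet_form_adjoint_self_op[OF g KKu, symmetric, unfolded u_def])
    fix f assume f: "f \<in> L2 \<mu>"
    then have f': "f \<in> borel_measurable borel"
      by (simp add: L2_def)
    have "kernel_integral ?PX f \<in> borel_measurable borel"
      unfolding kernel_integral_def gibbs_X_kernel_def[abs_def]
      by (rule measurable_compose[OF measurable_prob_algebraD[OF measurable_bind_prob_space[OF KY KX]]
            integral_measurable_subprob_algebra[OF f']])
    then have "L2_inner \<mu> (kernel_integral ?PX f) u = L2_inner \<pi> (kernel_integral ?P (\<lambda>z. f (fst z))) (\<lambda>z. u (fst z))"
      using u' f' by (simp add: inner kernel_integral_gibbs_fst)
    \<comment> \<open>The adjoint relation for the marginal kernel is the one for the Gibbs kernel
      at the lift of \<open>f\<close>, followed by conditioning the witness on the first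
      coordinate.\<close>
    also have "\<dots> = L2_inner \<mu> f (kernel_integral KY (kernel_integral KX u))"
      by (simp add: L2_inner_gibbs[OF lift[OF f] u] L2_inner_SY[OF f h] kernel_integral_SY_snd[OF Ku'])
    finally show "L2_inner \<mu> (kernel_integral ?PX f) (kernel_integral ?PX g)
        = L2_inner \<mu> f (kernel_integral KY (kernel_integral KX (kernel_integral ?PX g)))"
      by (simp add: u_def)
  qed
  finally show ?thesis .
qed

end

theorem theorem3p4:
  fixes \<pi> :: "('a::polish_space \<times> 'b::polish_space) measure"
    and KY :: "'a \<Rightarrow> 'b measure"
    and KX :: "'b \<Rightarrow> 'a measure"
    and \<beta> :: "real \<Rightarrow> real"
  assumes "prob_space \<pi>"
    and "sets \<pi> = sets (borel \<Otimes>\<^sub>M borel)"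
    and "regular_conditional \<pi> fst snd KY"
    and "regular_conditional \<pi> snd fst KX"
    and "weak_poincare \<pi> (adjoint_self_op \<pi> (gibbs_kernel KY KX)) \<beta>"
  shows "weak_poincare (distr \<pi> borel fst)
           (adjoint_self_op (distr \<pi> borel fst) (gibbs_X_kernel KY KX)) \<beta>"
proof -
  interpret two_component_gibbs \<pi> KY KX
    by (intro two_component_gibbs.intro two_component_gibbs_axioms.intro assms)
  have "ereal ((L2_norm \<mu> g)\<^sup>2)
      \<le> ereal (s * dirichlet_form \<mu> (adjoint_self_op \<mu> (gibbs_X_kernel KY KX)) g)
        + ereal (\<beta> s) * (osc_norm \<mu> g)\<^sup>2"
    if s: "s > 0" and g: "g \<in> L2_zero \<mu>" for s g
  proof -
    have g': "g \<in> L2 \<mu>" "g \<in> borel_measurable borel"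
      using g by (simp_all add: L2_zero_def L2_def)
    have "(\<lambda>z. g (fst z)) \<in> L2_zero \<pi>"
      using g g' by (simp add: L2_zero_distr_iff)
    with assms(5) s have "ereal ((L2_norm \<pi> (\<lambda>z. g (fst z)))\<^sup>2)
      \<le> ereal (s * dirichlet_form \<pi> (adjoint_self_op \<pi> (gibbs_kernel KY KX)) (\<lambda>z. g (fst z)))
        + ereal (\<beta> s) * (osc_norm \<pi> (\<lambda>z. g (fst z)))\<^sup>2"
      by (simp add: weak_poincare_def)
    then show ?thesis
      \<comment> \<open>As \<mu> is the image of \<pi> under \<open>fst\<close>, lifting
        \<open>g\<close> changes neither its norm nor its oscillation, and the Dirichlet forms
        agree; hence the same \<beta> serves.\<close>
      using g' by (simp add: dirichlet_form_gibbs L2_norm_distr osc_norm_distr)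
  qed
  with assms(5) show ?thesis
    by (simp add: weak_poincare_def)
qed

end
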